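(* Let $n \geq 4$ and let $p(z)=\sum_{j=0}^{n} a_j z^j$ be a real polynomial with positive coefficients $a_0,\dots,a_n>0$. Define $$\alpha=\max\left\{\frac{a_{n-2}}{a_n},\frac{a_{n-3}}{a_{n-1}}\right\},\quad \beta=\max\left\{0,\ \max_{0\leq j\leq n-4}\frac{a_j-\alpha a_{j+2}}{a_{j+4}}\right\},\quad \mu_1=\left(\tfrac12\left(\alpha+(\alpha^2+4\beta)^{1/2}\right)\right)^{1/2},$$ and $$\gamma=\max\left\{\frac{a_2}{a_0},\frac{a_3}{a_1}\right\},\quad \delta=\max\left\{0,\ \max_{0\leq j\leq n-4}\frac{a_{j+4}-\gamma a_{j+2}}{a_j}\right\},\quad \mu_2=\left(\tfrac12\left(\gamma+(\gamma^2+4\delta)^{1/2}\right)\right)^{-1/2}.$$ Then all the zeros of $p$ lie in the closed disk $D(a_{n-1}/a_n,\mu_1)$, but are excluded from the open disk $\Delta(a_0/a_1,\mu_2)$.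
   Context: Zeros are complex zeros. For a number $a$ and $\gamma>0$, define $$D(a,\gamma)=\{z\in\mathbb{C}:|z+a|\leq |a|+\gamma\},\qquad \Delta(a,\gamma)=\left\{z\in\mathbb{C}:\left|z-\frac{\gamma^2}{|a|+2\gamma}\right|<\frac{\gamma(|a|+\gamma)}{|a|+2\gamma}\right\}.$$ (Here $a,\gamma$ are dummy arguments of $D$ and $\Delta$.) *)

theory Defs
  imports Complex_Main "HOL-Computational_Algebra.Polynomial"
begin

definition disk_D :: "complex \<Rightarrow> real \<Rightarrow> complex set" where
  "disk_D a g = {z. cmod (z + a) \<le> cmod a + g}"

definition disk_Delta :: "complex \<Rightarrow> real \<Rightarrow> complex set" where
  "disk_Delta a g =
    {z. cmod (z - complex_of_real (g\<^sup>2 / (cmod a + 2 * g)))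
          < g * (cmod a + g) / (cmod a + 2 * g)}"

text \<open>
  The quantities below depend on a coefficient sequence \<open>a\<close> and on the degree \<open>n\<close>.
  They are meant for \<open>n \<ge> 4\<close>, so that the subtractions on \<open>nat\<close> do not truncate.
\<close>

definition coeff_alpha :: "(nat \<Rightarrow> real) \<Rightarrow> nat \<Rightarrow> real" where
  "coeff_alpha a n = max (a (n - 2) / a n) (a (n - 3) / a (n - 1))"

definition coeff_beta :: "(nat \<Rightarrow> real) \<Rightarrow> nat \<Rightarrow> real" where
  "coeff_beta a n =
    max 0 (Max ((\<lambda>j. (a j - coeff_alpha a n * a (j + 2)) / a (j + 4)) ` {0..n - 4}))"

definition coeff_mu1 :: "(nat \<Rightarrow> real) \<Rightarrow> nat \<Rightarrow> real" where
  "coeff_mu1 a n =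
    sqrt (1 / 2 * (coeff_alpha a n + sqrt ((coeff_alpha a n)\<^sup>2 + 4 * coeff_beta a n)))"

definition coeff_gamma :: "(nat \<Rightarrow> real) \<Rightarrow> real" where
  "coeff_gamma a = max (a 2 / a 0) (a 3 / a 1)"

definition coeff_delta :: "(nat \<Rightarrow> real) \<Rightarrow> nat \<Rightarrow> real" where
  "coeff_delta a n =
    max 0 (Max ((\<lambda>j. (a (j + 4) - coeff_gamma a * a (j + 2)) / a j) ` {0..n - 4}))"

definition coeff_mu2 :: "(nat \<Rightarrow> real) \<Rightarrow> nat \<Rightarrow> real" where
  "coeff_mu2 a n =
    1 / sqrt (1 / 2 * (coeff_gamma a + sqrt ((coeff_gamma a)\<^sup>2 + 4 * coeff_delta a n)))"

end

theory Submission
  imports Defs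
begin

text \<open>
  Write \<open>\<mu> = \<mu>\<^sub>1\<close> and \<open>a = a\<^bsub>n-1\<^esub> / a\<^sub>n\<close>. By construction \<open>\<mu>\<close> is the positive zero of
  \<open>x\<^sup>4 - \<alpha> x\<^sup>2 - \<beta>\<close>, and the maxima defining \<open>\<alpha>\<close> and \<open>\<beta>\<close> make
  \<open>a\<^sub>k \<le> \<alpha> a\<^bsub>k+2\<^esub> + \<beta> a\<^bsub>k+4\<^esub>\<close> hold for all \<open>k \<le> n - 2\<close>, with coefficients beyond the degree
  read as \<open>0\<close>. Hence in the product
  \<open>(z\<^sup>4 - \<alpha> z\<^sup>2 - \<beta>) p(z)\<close> only the two leading coefficients, which are those of \<open>p\<close>, can be
  positive.

  A real polynomial with this sign pattern admits a refinement of Cauchy's classical bound: if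
  \<open>\<mu>\<close> is a positive zero and \<open>z\<close> a complex zero with \<open>\<bar>z\<bar> \<ge> \<mu>\<close>, then comparing the two leading
  terms with the remaining ones at \<open>z\<close> and at \<open>\<mu>\<close> gives \<open>\<bar>z\<bar> \<bar>z + a\<bar> \<le> \<mu> (\<mu> + a)\<close>
  (lemma \<open>cauchy_bound_two_leading_terms\<close>). Therefore \<open>\<bar>z + a\<bar> \<le> a + \<mu>\<close>, and for
  \<open>\<bar>z\<bar> < \<mu>\<close> this is just the triangle inequality. So every zero lies in \<open>D(a, \<mu>)\<close>.

  For the excluded disk, apply this to the reversed polynomial, whose zeros are the reciprocals
  of those of \<open>p\<close>; passing to it turns \<open>\<gamma>\<close> and \<open>\<delta>\<close> into \<open>\<alpha>\<close> and \<open>\<beta>\<close>, and \<open>\<mu>\<^sub>2\<close>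
  into \<open>1 / \<mu>\<^sub>1\<close>. Inversion carries the complement of the disk \<open>D(1/A, 1/g)\<close> to the disk
  \<open>\<Delta>(A, g)\<close> without \<open>0\<close>, an Apollonius disk for the points \<open>-A\<close> and \<open>0\<close>
  (lemma \<open>inverse_in_disk_D_imp_notin_disk_Delta\<close>).
\<close>

section \<open>A Cauchy bound that keeps the two leading terms\<close>

lemma poly_split_two_leading_terms:
  fixes f :: "'a::comm_ring_1 poly"
  assumes "degree f \<le> m + 2"
  shows "poly f x = (\<Sum>j\<le>m. coeff f j * x ^ j)
           + x ^ (m + 1) * (coeff f (m + 2) * x + coeff f (m + 1))"
proof -
  have "poly f x = (\<Sum>j\<le>m + 2. coeff f j * x ^ j)"
    unfolding poly_altdef using assms
    by (intro sum.mono_neutral_left) (auto simp: coeff_eq_0)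
  then show ?thesis
    by (simp add: algebra_simps)
qed

text \<open>
  The lower terms have a common sign, so at \<open>\<mu>\<close> their sum of absolute values is exactly the value
  of the two leading terms. Passing from \<open>\<mu>\<close> to \<open>z\<close> multiplies that sum by at most
  \<open>(\<bar>z\<bar> / \<mu>)\<^sup>m\<close>, whereas the power of \<open>z\<close> in front of the leading factor is one degree higher.
\<close>

lemma cauchy_bound_two_leading_terms:
  fixes q :: "real poly" and z :: complex
  assumes deg: "degree q \<le> m + 2"
    and nonpos: "\<And>j. j \<le> m \<Longrightarrow> coeff q j \<le> 0"
    and root: "poly q \<mu> = 0" and pos: "\<mu> > 0"
    and zero: "poly (map_poly complex_of_real q) z = 0" and far: "cmod z \<ge> \<mu>"
  shows "cmod z * cmod (of_real (coeff q (m + 2)) * z + of_real (coeff q (m + 1)))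
           \<le> \<mu> * (coeff q (m + 2) * \<mu> + coeff q (m + 1))"
proof -
  define L where "L = of_real (coeff q (m + 2)) * z + complex_of_real (coeff q (m + 1))"
  define M where "M = coeff q (m + 2) * \<mu> + coeff q (m + 1)"
  have split_z: "(\<Sum>j\<le>m. of_real (coeff q j) * z ^ j) + z ^ (m + 1) * L = 0"
    using zero poly_split_two_leading_terms[of "map_poly complex_of_real q" m z] deg
    by (simp add: L_def degree_map_poly coeff_map_poly)
  have split_\<mu>: "(\<Sum>j\<le>m. - coeff q j * \<mu> ^ j) = \<mu> ^ (m + 1) * M"
    using root poly_split_two_leading_terms[OF deg, of \<mu>]
    by (simp add: M_def sum_negf)
  have "cmod z ^ (m + 1) * cmod L = cmod (z ^ (m + 1) * L)"
    by (simp add: norm_mult norm_power)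
  also have "\<dots> = cmod (\<Sum>j\<le>m. of_real (coeff q j) * z ^ j)"
    using split_z by (metis add_eq_0_iff norm_minus_cancel)
  also have "\<dots> \<le> (\<Sum>j\<le>m. - coeff q j * cmod z ^ j)"
    using nonpos by (intro sum_norm_le) (simp add: norm_mult norm_power)
  also have "\<dots> \<le> (\<Sum>j\<le>m. - coeff q j * (\<mu> ^ j * (cmod z / \<mu>) ^ m))"
  proof (rule sum_mono)
    fix j assume "j \<in> {..m}"
    then have "j \<le> m" by simp
    have "(cmod z / \<mu>) ^ j \<le> (cmod z / \<mu>) ^ m"
      using far pos \<open>j \<le> m\<close> by (intro power_increasing) auto
    then have "\<mu> ^ j * (cmod z / \<mu>) ^ j \<le> \<mu> ^ j * (cmod z / \<mu>) ^ m"
      using pos by (intro mult_left_mono) auto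
    then have "cmod z ^ j \<le> \<mu> ^ j * (cmod z / \<mu>) ^ m"
      using pos by (simp add: power_divide)
    then show "- coeff q j * cmod z ^ j \<le> - coeff q j * (\<mu> ^ j * (cmod z / \<mu>) ^ m)"
      using nonpos[OF \<open>j \<le> m\<close>] by (intro mult_left_mono) auto
  qed
  also have "\<dots> = (\<Sum>j\<le>m. - coeff q j * \<mu> ^ j) * (cmod z / \<mu>) ^ m"
    unfolding sum_distrib_right by (simp add: mult.assoc)
  also have "\<dots> = cmod z ^ m * (\<mu> * M)"
    unfolding split_\<mu> using pos by (simp add: power_divide)
  finally have "cmod z ^ m * (cmod z * cmod L) \<le> cmod z ^ m * (\<mu> * M)"
    by (simp add: mult_ac)
  moreover have "cmod z ^ m > 0"
    by (rule zero_less_power) (use far pos in linarith)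
  ultimately have "cmod z * cmod L \<le> \<mu> * M"
    by (rule mult_left_le_imp_le)
  then show ?thesis
    by (simp add: L_def M_def)
qed

section \<open>The disk containing all zeros\<close>

text \<open>
  The recurrence inequality says that multiplying by \<open>x\<^sup>4 - \<alpha> x\<^sup>2 - \<beta>\<close> makes all but the two
  leading coefficients nonpositive; the four lowest coefficients receive nothing from \<open>x\<^sup>4\<close>, so
  their sign is immediate.
\<close>

lemma zeros_in_disk_of_recurrence:
  fixes p :: "real poly" and z :: complex
  assumes deg: "degree p = n" and "n \<ge> 2"
    and pos: "\<And>j. j \<le> n \<Longrightarrow> coeff p j > 0"
    and "\<alpha> \<ge> 0" "\<beta> \<ge> 0" "\<mu> > 0" and \<mu>: "\<mu> ^ 4 = \<alpha> * \<mu>\<^sup>2 + \<beta>"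
    and rec: "\<And>k. k \<le> n - 2 \<Longrightarrow> coeff p k \<le> \<alpha> * coeff p (k + 2) + \<beta> * coeff p (k + 4)"
    and zero: "poly (map_poly complex_of_real p) z = 0"
  shows "z \<in> disk_D (complex_of_real (coeff p (n - 1) / coeff p n)) \<mu>"
proof -
  define a where "a = coeff p (n - 1) / coeff p n"
  have "coeff p n > 0" "coeff p (n - 1) > 0"
    using pos by auto
  then have "a > 0" by (simp add: a_def)
  have "cmod (z + of_real a) \<le> a + \<mu>"
  proof (cases "cmod z \<ge> \<mu>")
    case False
    then show ?thesis
      using norm_triangle_ineq[of z "of_real a"] \<open>a > 0\<close> by simp
  next
    case True
    define q where "q = monom 1 4 * p - smult \<alpha> (monom 1 2 * p) - smult \<beta> p"
    have coeff_q: "coeff q j = (if j < 4 then 0 else coeff p (j - 4))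
        - \<alpha> * (if j < 2 then 0 else coeff p (j - 2)) - \<beta> * coeff p j" for j
      by (simp add: q_def coeff_monom_mult)
    have nonneg: "coeff p j \<ge> 0" for j
      using pos[of j] deg coeff_eq_0[of p j] by (cases "j \<le> n") auto
    have "poly q \<mu> = (\<mu> ^ 4 - \<alpha> * \<mu>\<^sup>2 - \<beta>) * poly p \<mu>"
      by (simp add: q_def poly_monom algebra_simps)
    then have root: "poly q \<mu> = 0"
      using \<mu> by simp
    have "map_poly complex_of_real q = monom 1 4 * map_poly of_real p
        - smult (of_real \<alpha>) (monom 1 2 * map_poly of_real p)
        - smult (of_real \<beta>) (map_poly of_real p)"
      by (rule poly_eqI) (simp add: coeff_map_poly coeff_monom_mult coeff_q)
    then have zero_q: "poly (map_poly complex_of_real q) z = 0"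
      using zero by simp
    have deg_q: "degree q \<le> (n + 2) + 2"
      by (rule degree_le) (use deg in \<open>auto simp: coeff_q coeff_eq_0\<close>)
    have nonpos: "coeff q j \<le> 0" if "j \<le> n + 2" for j
    proof (cases "j < 4")
      case True
      have "\<alpha> * (if j < 2 then 0 else coeff p (j - 2)) \<ge> 0" "\<beta> * coeff p j \<ge> 0"
        using nonneg assms(4,5) by (auto intro!: mult_nonneg_nonneg)
      with True show ?thesis
        by (simp only: coeff_q if_True)
    next
      case False
      then obtain k where j: "j = k + 4"
        by (metis add.commute le_Suc_ex not_less)
      with that have "k \<le> n - 2" by simp
      moreover have "coeff q j = coeff p k - \<alpha> * coeff p (k + 2) - \<beta> * coeff p (k + 4)"
        by (simp add: coeff_q j)
      ultimately show ?thesis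
        using rec[of k] by simp
    qed
    have top: "coeff q (n + 2 + 2) = coeff p n" "coeff q (n + 2 + 1) = coeff p (n - 1)"
      using \<open>n \<ge> 2\<close> deg by (auto simp: coeff_q coeff_eq_0 numeral_eq_Suc)
    have "of_real (coeff p n) * z + complex_of_real (coeff p (n - 1))
        = of_real (coeff p n) * (z + of_real a)"
      using \<open>coeff p n > 0\<close> by (simp add: a_def field_simps)
    moreover have "coeff p n * \<mu> + coeff p (n - 1) = coeff p n * (\<mu> + a)"
      using \<open>coeff p n > 0\<close> by (simp add: a_def field_simps)
    ultimately have "cmod z * (coeff p n * cmod (z + of_real a)) \<le> \<mu> * (coeff p n * (\<mu> + a))"
      using cauchy_bound_two_leading_terms[OF deg_q nonpos root \<open>\<mu> > 0\<close> zero_q True]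
        \<open>coeff p n > 0\<close> unfolding top by (simp add: norm_mult)
    then have "coeff p n * (cmod z * cmod (z + of_real a)) \<le> coeff p n * (\<mu> * (\<mu> + a))"
      by (simp only: mult_ac)
    then have "cmod z * cmod (z + of_real a) \<le> \<mu> * (\<mu> + a)"
      using \<open>coeff p n > 0\<close> by simp
    moreover have "\<mu> * cmod (z + of_real a) \<le> cmod z * cmod (z + of_real a)"
      using True by (intro mult_right_mono) auto
    ultimately have "\<mu> * cmod (z + of_real a) \<le> \<mu> * (\<mu> + a)"
      by linarith
    then show ?thesis
      using \<open>\<mu> > 0\<close> by simp
  qed
  then show ?thesis
    using \<open>a > 0\<close> unfolding a_def[symmetric] by (simp add: disk_D_def)
qed

lemma sqrt_root_of_biquadratic:
  fixes \<alpha> \<beta> :: real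
  assumes "\<alpha> > 0" "\<beta> \<ge> 0"
  defines "\<mu> \<equiv> sqrt (1 / 2 * (\<alpha> + sqrt (\<alpha>\<^sup>2 + 4 * \<beta>)))"
  shows "\<mu> > 0" "\<mu> ^ 4 = \<alpha> * \<mu>\<^sup>2 + \<beta>"
proof -
  define s where "s = sqrt (\<alpha>\<^sup>2 + 4 * \<beta>)"
  have "s \<ge> 0" and s2: "s\<^sup>2 = \<alpha>\<^sup>2 + 4 * \<beta>"
    using assms by (auto simp: s_def)
  show "\<mu> > 0"
    using \<open>\<alpha> > 0\<close> \<open>s \<ge> 0\<close> by (simp add: \<mu>_def flip: s_def)
  have \<mu>2: "\<mu>\<^sup>2 = (\<alpha> + s) / 2"
    using \<open>\<alpha> > 0\<close> \<open>s \<ge> 0\<close> by (simp add: \<mu>_def flip: s_def)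
  have "\<mu> ^ 4 = (\<mu>\<^sup>2)\<^sup>2"
    by simp
  also have "\<dots> = \<alpha> * \<mu>\<^sup>2 + \<beta>"
    unfolding \<mu>2 using s2 by (simp add: field_simps power2_eq_square)
  finally show "\<mu> ^ 4 = \<alpha> * \<mu>\<^sup>2 + \<beta>" .
qed

lemma coeff_mu1_properties:
  assumes pos: "\<And>j. j \<le> n \<Longrightarrow> a j > 0"
  shows "coeff_alpha a n > 0" "coeff_beta a n \<ge> 0" "coeff_mu1 a n > 0"
    "coeff_mu1 a n ^ 4 = coeff_alpha a n * (coeff_mu1 a n)\<^sup>2 + coeff_beta a n"
proof -
  show \<alpha>: "coeff_alpha a n > 0"
    unfolding coeff_alpha_def using pos[of "n - 2"] pos[of n] by (simp add: less_max_iff_disj)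
  show \<beta>: "coeff_beta a n \<ge> 0"
    by (simp add: coeff_beta_def)
  show "coeff_mu1 a n > 0"
    "coeff_mu1 a n ^ 4 = coeff_alpha a n * (coeff_mu1 a n)\<^sup>2 + coeff_beta a n"
    unfolding coeff_mu1_def using sqrt_root_of_biquadratic[OF \<alpha> \<beta>] by auto
qed

text \<open>
  The maximum in \<open>\<beta>\<close> takes care of \<open>k \<le> n - 4\<close>. For the two remaining indices the
  \<open>\<beta>\<close>-term vanishes, and these are the indices over which \<open>\<alpha>\<close> is the maximal ratio.
\<close>

lemma coeff_recurrence:
  assumes "n \<ge> 4" and pos: "\<And>j. j \<le> n \<Longrightarrow> a j > 0"
    and vanish: "\<And>j. j > n \<Longrightarrow> a j = 0" and "k \<le> n - 2"
  shows "a k \<le> coeff_alpha a n * a (k + 2) + coeff_beta a n * a (k + 4)"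
proof (cases "k \<le> n - 4")
  case True
  then have "a (k + 4) > 0"
    using pos \<open>n \<ge> 4\<close> by simp
  have "(a k - coeff_alpha a n * a (k + 2)) / a (k + 4) \<le> coeff_beta a n"
    unfolding coeff_beta_def using True by (intro max.coboundedI2 Max_ge) auto
  then show ?thesis
    using \<open>a (k + 4) > 0\<close> by (simp add: divide_le_eq algebra_simps)
next
  case False
  with \<open>k \<le> n - 2\<close> \<open>n \<ge> 4\<close> have k: "k = n - 3 \<or> k = n - 2" and "k + 2 \<le> n" and "a (k + 4) = 0"
    by (auto intro: vanish)
  have idx: "n - 3 + 2 = n - 1" "n - 2 + 2 = n"
    using \<open>n \<ge> 4\<close> by auto
  have "a k / a (k + 2) \<le> coeff_alpha a n"
    using k unfolding coeff_alpha_def by (elim disjE) (simp_all only: idx max.cobounded1 max.cobounded2)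
  then show ?thesis
    using pos[OF \<open>k + 2 \<le> n\<close>] \<open>a (k + 4) = 0\<close> by (simp add: divide_le_eq)
qed

lemma zeros_in_disk_D:
  fixes p :: "real poly" and z :: complex
  assumes "n \<ge> 4" "degree p = n" and pos: "\<And>j. j \<le> n \<Longrightarrow> coeff p j > 0"
    and zero: "poly (map_poly complex_of_real p) z = 0"
  shows "z \<in> disk_D (complex_of_real (coeff p (n - 1) / coeff p n)) (coeff_mu1 (coeff p) n)"
proof (rule zeros_in_disk_of_recurrence[OF \<open>degree p = n\<close> _ pos])
  note props = coeff_mu1_properties[of n "coeff p", OF pos]
  show "coeff_alpha (coeff p) n \<ge> 0" "coeff_beta (coeff p) n \<ge> 0" "coeff_mu1 (coeff p) n > 0"
    "coeff_mu1 (coeff p) n ^ 4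
       = coeff_alpha (coeff p) n * (coeff_mu1 (coeff p) n)\<^sup>2 + coeff_beta (coeff p) n"
    using props by auto
  show "coeff p k \<le> coeff_alpha (coeff p) n * coeff p (k + 2)
      + coeff_beta (coeff p) n * coeff p (k + 4)" if "k \<le> n - 2" for k
    using assms that by (intro coeff_recurrence) (auto simp: coeff_eq_0)
qed (use assms in auto)

section \<open>The excluded disk, by inversion\<close>

text \<open>
  With \<open>w = 1 / z\<close> the hypothesis reads \<open>g \<bar>z + A\<bar> \<le> (A + g) \<bar>z\<bar>\<close>. After squaring, it and the
  conclusion both become \<open>2 g\<^sup>2 Re z + g\<^sup>2 A \<le> (A + 2 g) \<bar>z\<bar>\<^sup>2\<close>.
\<close>

lemma inverse_in_disk_D_imp_notin_disk_Delta:
  fixes z :: complex and A g :: real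
  assumes "A > 0" "g > 0" "z \<noteq> 0"
    and mem: "inverse z \<in> disk_D (complex_of_real (1 / A)) (1 / g)"
  shows "z \<notin> disk_Delta (complex_of_real A) g"
proof -
  define x y where "x = Re z" and "y = Im z"
  have le: "cmod (inverse z + of_real (1 / A)) \<le> 1 / A + 1 / g"
    using mem \<open>A > 0\<close> by (simp add: disk_D_def norm_divide)
  have "z + of_real A = of_real A * z * (inverse z + of_real (1 / A))"
    using \<open>z \<noteq> 0\<close> \<open>A > 0\<close> by (simp add: field_simps)
  then have "g * cmod (z + of_real A) = g * (A * cmod z) * cmod (inverse z + of_real (1 / A))"
    using \<open>A > 0\<close> by (simp add: norm_mult)
  also have "\<dots> \<le> g * (A * cmod z) * (1 / A + 1 / g)"
    using le assms by (intro mult_left_mono) auto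
  also have "\<dots> = (A + g) * cmod z"
    using assms by (simp add: field_simps)
  finally have "(g * cmod (z + of_real A))\<^sup>2 \<le> ((A + g) * cmod z)\<^sup>2"
    using assms by (intro power_mono) auto
  then have "g\<^sup>2 * ((x + A)\<^sup>2 + y\<^sup>2) \<le> (A + g)\<^sup>2 * (x\<^sup>2 + y\<^sup>2)"
    by (simp add: power_mult_distrib cmod_power2 x_def y_def)
  then have "A * (2 * g\<^sup>2 * x + g\<^sup>2 * A) \<le> A * ((A + 2 * g) * (x\<^sup>2 + y\<^sup>2))"
    by (simp add: power2_eq_square algebra_simps)
  then have main: "2 * g\<^sup>2 * x + g\<^sup>2 * A \<le> (A + 2 * g) * (x\<^sup>2 + y\<^sup>2)"
    using \<open>A > 0\<close> by simp
  define h where "h = A + 2 * g"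
  have "h > 0" using assms by (simp add: h_def)
  have "(g * (A + g))\<^sup>2 = h * (g\<^sup>2 * A) + (g\<^sup>2)\<^sup>2"
    by (simp add: h_def power2_eq_square algebra_simps)
  also have "\<dots> \<le> h * (h * (x\<^sup>2 + y\<^sup>2) - 2 * g\<^sup>2 * x) + (g\<^sup>2)\<^sup>2"
    using main \<open>h > 0\<close> by (simp add: h_def)
  also have "\<dots> = h\<^sup>2 * ((x - g\<^sup>2 / h)\<^sup>2 + y\<^sup>2)"
    using \<open>h > 0\<close> by (simp add: field_simps power2_eq_square)
  also have "\<dots> = (h * cmod (z - of_real (g\<^sup>2 / h)))\<^sup>2"
    by (simp add: power_mult_distrib cmod_power2 x_def y_def)
  finally have "g * (A + g) \<le> h * cmod (z - of_real (g\<^sup>2 / h))"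
    by (rule power2_le_imp_le) (use \<open>h > 0\<close> in auto)
  then have "g * (A + g) / h \<le> cmod (z - of_real (g\<^sup>2 / h))"
    using \<open>h > 0\<close> by (simp add: divide_le_eq mult.commute)
  then show ?thesis
    using \<open>A > 0\<close> by (simp add: disk_Delta_def h_def)
qed

lemma coeff_mu2_eq_inverse_mu1_reversed:
  assumes "n \<ge> 4" and rev: "\<And>j. j \<le> n \<Longrightarrow> b j = a (n - j)"
  shows "coeff_mu2 a n = 1 / coeff_mu1 b n"
proof -
  have \<alpha>: "coeff_alpha b n = coeff_gamma a"
    using \<open>n \<ge> 4\<close> by (simp add: coeff_alpha_def coeff_gamma_def rev)
  have "(\<lambda>j. (b j - coeff_gamma a * b (j + 2)) / b (j + 4)) ` {0..n - 4}
      = (\<lambda>j. (a (j + 4) - coeff_gamma a * a (j + 2)) / a j) ` (\<lambda>j. n - 4 - j) ` {0..n - 4}"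
    unfolding image_image
  proof (rule image_cong[OF refl])
    fix j assume "j \<in> {0..n - 4}"
    with \<open>n \<ge> 4\<close> have "n - 4 - j + 4 = n - j" "n - 4 - j + 2 = n - (j + 2)"
      "n - 4 - j = n - (j + 4)" "j + 4 \<le> n" by auto
    then show "(b j - coeff_gamma a * b (j + 2)) / b (j + 4)
        = (a (n - 4 - j + 4) - coeff_gamma a * a (n - 4 - j + 2)) / a (n - 4 - j)"
      using rev[of j] rev[of "j + 2"] rev[of "j + 4"] by simp
  qed
  also have "(\<lambda>j. n - 4 - j) ` {0..n - 4} = {0..n - 4}"
  proof
    show "{0..n - 4} \<subseteq> (\<lambda>j. n - 4 - j) ` {0..n - 4}"
    proof
      fix j assume "j \<in> {0..n - 4}"
      then show "j \<in> (\<lambda>j. n - 4 - j) ` {0..n - 4}"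
        by (intro image_eqI[where x = "n - 4 - j"]) auto
    qed
  qed auto
  finally have "coeff_beta b n = coeff_delta a n"
    by (simp add: coeff_beta_def coeff_delta_def \<alpha>)
  with \<alpha> show ?thesis
    by (simp add: coeff_mu2_def coeff_mu1_def)
qed

lemma zeros_notin_disk_Delta:
  fixes p :: "real poly" and z :: complex
  assumes "n \<ge> 4" and deg: "degree p = n" and pos: "\<And>j. j \<le> n \<Longrightarrow> coeff p j > 0"
    and zero: "poly (map_poly complex_of_real p) z = 0"
  shows "z \<notin> disk_Delta (complex_of_real (coeff p 0 / coeff p 1)) (coeff_mu2 (coeff p) n)"
proof -
  define r where "r = reflect_poly p"
  have "coeff p 0 > 0" "coeff p 1 > 0"
    using pos \<open>n \<ge> 4\<close> by auto
  have "poly (map_poly complex_of_real p) 0 \<noteq> 0"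
    using \<open>coeff p 0 > 0\<close> by (simp add: poly_0_coeff_0 coeff_map_poly)
  with zero have "z \<noteq> 0" by auto
  have deg_r: "degree r = n"
    using \<open>coeff p 0 > 0\<close> deg by (simp add: r_def)
  have coeff_r: "coeff r j = coeff p (n - j)" if "j \<le> n" for j
    using that deg by (simp add: r_def coeff_reflect_poly)
  have pos_r: "coeff r j > 0" if "j \<le> n" for j
    using that pos by (simp add: coeff_r)
  have "map_poly complex_of_real r = reflect_poly (map_poly complex_of_real p)"
    by (rule poly_eqI) (simp add: r_def coeff_map_poly coeff_reflect_poly degree_map_poly)
  then have "poly (map_poly complex_of_real r) (inverse z) = 0"
    using zero \<open>z \<noteq> 0\<close> by (simp add: poly_reflect_poly_nz)
  from zeros_in_disk_D[OF \<open>n \<ge> 4\<close> deg_r pos_r this]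
  have "inverse z \<in> disk_D (complex_of_real (1 / (coeff p 0 / coeff p 1)))
      (1 / coeff_mu2 (coeff p) n)"
    using \<open>n \<ge> 4\<close> coeff_mu2_eq_inverse_mu1_reversed[of n "coeff r" "coeff p"]
    by (simp add: coeff_r)
  moreover have "coeff_mu2 (coeff p) n > 0"
    using coeff_mu1_properties(3)[of n "coeff r"] pos_r \<open>n \<ge> 4\<close>
      coeff_mu2_eq_inverse_mu1_reversed[of n "coeff r" "coeff p"] by (simp add: coeff_r)
  ultimately show ?thesis
    using \<open>coeff p 0 > 0\<close> \<open>coeff p 1 > 0\<close> \<open>z \<noteq> 0\<close>
    by (intro inverse_in_disk_D_imp_notin_disk_Delta) auto
qed

theorem theorem4p3:
  fixes p :: "real poly" and n :: nat
  assumes "n \<ge> 4"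
    and "degree p = n"
    and "\<forall>j\<le>n. coeff p j > 0"
  shows "{z :: complex. poly (map_poly complex_of_real p) z = 0}
           \<subseteq> disk_D (complex_of_real (coeff p (n - 1) / coeff p n)) (coeff_mu1 (coeff p) n)
       \<and> {z :: complex. poly (map_poly complex_of_real p) z = 0}
           \<inter> disk_Delta (complex_of_real (coeff p 0 / coeff p 1)) (coeff_mu2 (coeff p) n) = {}"
  using zeros_in_disk_D[OF assms(1,2)] zeros_notin_disk_Delta[OF assms(1,2)] assms(3) by blast

end
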